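(* In the Delsarte-dual setting of the context, assume $w_U(H)<n-1$ for every $\mathbb{F}_{q^m}$-hyperplane $H$ of $\mathbb{V}(k,q^m)$, that $U$ is $h$-scattered for some positive integer $h$, and let $\varepsilon=\varepsilon_U(t_{s-1})$ be the maximum non-trivial defect of $U$ (the second-to-last term of its sequence of maximum non-zero defects). Then $U^d$ is $(n-k-\varepsilon-1)$-scattered in $\mathbb{V}(n-k,q^m)$. In particular, if $\varepsilon<n-k-1$ then $U^d$ is scattered.
   Context: Let $q$ be a prime power, $m$ a positive integer, $1\le k<n$. Let $\mathbb{V}(n,q^m)$ be an $n$-dim $\mathbb{F}_{q^m}$-space, $W$ an $n$-dim $\mathbb{F}_q$-subspace with $\langle W\rangle_{\mathbb{F}_{q^m}}=\mathbb{V}(n,q^m)$, $\sigma'$ a non-degenerate reflexive $\mathbb{F}_q$-bilinear form on $W$, $\sigma$ its $\mathbb{F}_{q^m}$-bilinear extension, $\perp$ orthogonal complement w.r.t. $\sigma$, $\Gamma$ an $(n-k)$-dim $\mathbb{F}_{q^m}$-subspace with $\Gamma\cap W=\{0\}$; $\mathbb{V}(k,q^m)=\mathbb{V}(n,q^m)/\Gamma$, $U=(W+\Gamma)/\Gamma$, $\mathbb{V}(n-k,q^m)=\mathbb{V}(n,q^m)/\Gamma^\perp$ and $U^d=(W+\Gamma^\perp)/\Gamma^\perp$ (a Delsarte dual). $w_U(T)=\dim_{\mathbb{F}_q}(U\cap T)$, $\varepsilon_U(T)=w_U(T)-\dim_{\mathbb{F}_{q^m}}T$, $\varepsilon_U(r)=\max$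 of $\varepsilon_U(T)$ over $r$-dimensional $T$. Since $0=\varepsilon_U(0)\le\dots\le\varepsilon_U(k)=n-k$, letting $\varepsilon_1<\dots<\varepsilon_s$ be the distinct positive values and $t_i=\min\{r:\varepsilon_U(r)=\varepsilon_i\}$ gives the sequence of maximum non-zero defects $\varepsilon_U(t_1)<\dots<\varepsilon_U(t_s)=n-k$ (the statement presupposes $s\ge2$ so that $t_{s-1}$ exists). An $\mathbb{F}_q$-subspace $U$ is $h$-scattered if $\dim_{\mathbb{F}_q}(U\cap T)\le h$ for every $h$-dimensional $\mathbb{F}_{q^m}$-subspace $T$; scattered means $1$-scattered. *)

theory Defs
  imports Complex_Main "HOL-Library.Cardinality"
begin

text \<open>
  The field extension of degree \<open>m\<close> is an embedding \<open>\<iota>\<close> of a finite field type \<open>'f\<close> (with \<open>q\<close>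
  elements) into a finite field type \<open>'k\<close> (with \<open>q ^ m\<close> elements).  A \<open>'k\<close>-vector space is a type with
  a scalar multiplication \<open>s\<close>; its \<open>'f\<close>-structure is obtained by restriction of scalars.
\<close>

definition field_embedding :: "('f::field \<Rightarrow> 'k::field) \<Rightarrow> bool" where
  "field_embedding \<iota> \<longleftrightarrow>
     \<iota> 1 = 1 \<and> (\<forall>a b. \<iota> (a + b) = \<iota> a + \<iota> b) \<and> (\<forall>a b. \<iota> (a * b) = \<iota> a * \<iota> b)"

definition restrict_scalars :: "('f \<Rightarrow> 'k) \<Rightarrow> ('k \<Rightarrow> 'v \<Rightarrow> 'v) \<Rightarrow> 'f \<Rightarrow> 'v \<Rightarrow> 'v" where
  "restrict_scalars \<iota> s = (\<lambda>a v. s (\<iota> a) v)"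

definition bilinear_form_on ::
    "('f::field \<Rightarrow> 'v::ab_group_add \<Rightarrow> 'v) \<Rightarrow> 'v set \<Rightarrow> ('v \<Rightarrow> 'v \<Rightarrow> 'f) \<Rightarrow> bool" where
  "bilinear_form_on s W \<beta> \<longleftrightarrow>
     (\<forall>x\<in>W. \<forall>y\<in>W. \<forall>z\<in>W. \<beta> (x + y) z = \<beta> x z + \<beta> y z \<and> \<beta> z (x + y) = \<beta> z x + \<beta> z y) \<and>
     (\<forall>c. \<forall>x\<in>W. \<forall>y\<in>W. \<beta> (s c x) y = c * \<beta> x y \<and> \<beta> x (s c y) = c * \<beta> x y)"

definition reflexive_form_on :: "'v set \<Rightarrow> ('v \<Rightarrow> 'v \<Rightarrow> 'f::zero) \<Rightarrow> bool" where
  "reflexive_form_on W \<beta> \<longleftrightarrow> (\<forall>x\<in>W. \<forall>y\<in>W. \<beta> x y = 0 \<longrightarrow> \<beta> y x = 0)"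

definition nondegenerate_form_on :: "('v::zero) set \<Rightarrow> ('v \<Rightarrow> 'v \<Rightarrow> 'f::zero) \<Rightarrow> bool" where
  "nondegenerate_form_on W \<beta> \<longleftrightarrow> (\<forall>x\<in>W. (\<forall>y\<in>W. \<beta> x y = 0) \<longrightarrow> x = 0)"

definition orth_compl :: "('v \<Rightarrow> 'v \<Rightarrow> 'k::zero) \<Rightarrow> 'v set \<Rightarrow> 'v set" where
  "orth_compl \<beta> A = {v. \<forall>a\<in>A. \<beta> v a = 0}"

text \<open>
  A quotient space is given with its canonical projection: the target of a surjective linear map with
  kernel \<open>G\<close>.
\<close>

definition quotient_projection ::
    "('k::field \<Rightarrow> 'v::ab_group_add \<Rightarrow> 'v) \<Rightarrow> 'v set \<Rightarrow>
     ('k \<Rightarrow> 'a::ab_group_add \<Rightarrow> 'a) \<Rightarrow> ('v \<Rightarrow> 'a) \<Rightarrow> bool" where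
  "quotient_projection s G s' p \<longleftrightarrow>
     Vector_Spaces.linear s s' p \<and> surj p \<and> {v. p v = 0} = G"

text \<open>\<open>(W + G) / G\<close> inside the quotient by \<open>G\<close> with projection \<open>p\<close>.\<close>

definition image_mod :: "('v::plus \<Rightarrow> 'a) \<Rightarrow> 'v set \<Rightarrow> 'v set \<Rightarrow> 'a set" where
  "image_mod p W G = p ` {w + g | w g. w \<in> W \<and> g \<in> G}"

definition weight ::
    "('f::field \<Rightarrow> 'k::field) \<Rightarrow> ('k \<Rightarrow> 'a::ab_group_add \<Rightarrow> 'a) \<Rightarrow> 'a set \<Rightarrow> 'a set \<Rightarrow> nat" where
  "weight \<iota> s U T = vector_space.dim (restrict_scalars \<iota> s) (U \<inter> T)"

definition defect ::
    "('f::field \<Rightarrow> 'k::field) \<Rightarrow> ('k \<Rightarrow> 'a::ab_group_add \<Rightarrow> 'a) \<Rightarrow> 'a set \<Rightarrow> 'a set \<Rightarrow> int" where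
  "defect \<iota> s U T = int (weight \<iota> s U T) - int (vector_space.dim s T)"

definition max_defect ::
    "('f::field \<Rightarrow> 'k::field) \<Rightarrow> ('k \<Rightarrow> 'a::ab_group_add \<Rightarrow> 'a) \<Rightarrow> 'a set \<Rightarrow> nat \<Rightarrow> int" where
  "max_defect \<iota> s U r =
     Max {defect \<iota> s U T | T. module.subspace s T \<and> vector_space.dim s T = r}"

text \<open>
  The increasing list of the distinct positive maximum defects.  The \<open>i\<close>-th term of the sequence
  (\<open>i = 1, 2, \<dots>\<close>) is the list entry with index \<open>i - 1\<close>.
\<close>

definition defect_values ::
    "('f::field \<Rightarrow> 'k::field) \<Rightarrow> ('k \<Rightarrow> 'a::ab_group_add \<Rightarrow> 'a) \<Rightarrow> 'a set \<Rightarrow> int list" where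
  "defect_values \<iota> s U =
     sorted_list_of_set {max_defect \<iota> s U r | r. r \<le> vector_space.dim s UNIV \<and> 0 < max_defect \<iota> s U r}"

definition defect_count ::
    "('f::field \<Rightarrow> 'k::field) \<Rightarrow> ('k \<Rightarrow> 'a::ab_group_add \<Rightarrow> 'a) \<Rightarrow> 'a set \<Rightarrow> nat" where
  "defect_count \<iota> s U = length (defect_values \<iota> s U)"

definition defect_position ::
    "('f::field \<Rightarrow> 'k::field) \<Rightarrow> ('k \<Rightarrow> 'a::ab_group_add \<Rightarrow> 'a) \<Rightarrow> 'a set \<Rightarrow> nat \<Rightarrow> nat" where
  "defect_position \<iota> s U i =
     (LEAST r. r \<le> vector_space.dim s UNIV \<and> max_defect \<iota> s U r = defect_values \<iota> s U ! (i - 1))"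

definition h_scattered ::
    "('f::field \<Rightarrow> 'k::field) \<Rightarrow> ('k \<Rightarrow> 'a::ab_group_add \<Rightarrow> 'a) \<Rightarrow> nat \<Rightarrow> 'a set \<Rightarrow> bool" where
  "h_scattered \<iota> s h U \<longleftrightarrow>
     module.subspace (restrict_scalars \<iota> s) U \<and>
     (\<forall>T. module.subspace s T \<and> vector_space.dim s T = h \<longrightarrow>
          vector_space.dim (restrict_scalars \<iota> s) (U \<inter> T) \<le> h)"

abbreviation scattered ::
    "('f::field \<Rightarrow> 'k::field) \<Rightarrow> ('k \<Rightarrow> 'a::ab_group_add \<Rightarrow> 'a) \<Rightarrow> 'a set \<Rightarrow> bool" where
  "scattered \<iota> s U \<equiv> h_scattered \<iota> s 1 U"

text \<open>
  \<open>'v\<close>, \<open>'a\<close> and \<open>'b\<close> are the spaces of dimension \<open>n\<close>, \<open>k\<close> and \<open>n - k\<close>.  That \<open>q\<close> is a prime power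
  is automatic from \<open>'f\<close> being a finite field, and finite-dimensionality of \<open>'v\<close> from its
  dimension being positive.  The form \<open>\<sigma>\<close> is determined by \<open>\<sigma>'\<close>, because \<open>W\<close> spans \<open>'v\<close>;
  values of \<open>\<sigma>'\<close> outside \<open>W\<close> are irrelevant.
\<close>

locale delsarte_setting =
  fixes q m n k :: nat
    and \<iota> :: "'f::{field,finite} \<Rightarrow> 'k::{field,finite}"
    and s :: "'k \<Rightarrow> 'v::ab_group_add \<Rightarrow> 'v"
    and W :: "'v set"
    and \<sigma>' :: "'v \<Rightarrow> 'v \<Rightarrow> 'f"
    and \<sigma> :: "'v \<Rightarrow> 'v \<Rightarrow> 'k"
    and \<Gamma> :: "'v set"
    and s\<^sub>1 :: "'k \<Rightarrow> 'a::ab_group_add \<Rightarrow> 'a"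
    and \<pi>\<^sub>1 :: "'v \<Rightarrow> 'a"
    and s\<^sub>2 :: "'k \<Rightarrow> 'b::ab_group_add \<Rightarrow> 'b"
    and \<pi>\<^sub>2 :: "'v \<Rightarrow> 'b"
  assumes card_F: "CARD('f) = q"
    and card_K: "CARD('k) = q ^ m"
    and m_pos: "0 < m"
    and k_pos: "1 \<le> k"
    and k_less: "k < n"
    and embedding: "field_embedding \<iota>"
    and vs: "vector_space s"
    and dim_V: "vector_space.dim s (UNIV :: 'v set) = n"
    and W_subspace: "module.subspace (restrict_scalars \<iota> s) W"
    and dim_W: "vector_space.dim (restrict_scalars \<iota> s) W = n"
    and span_W: "module.span s W = UNIV"
    and form_W: "bilinear_form_on (restrict_scalars \<iota> s) W \<sigma>'"
    and reflexive_W: "reflexive_form_on W \<sigma>'"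
    and nondegenerate_W: "nondegenerate_form_on W \<sigma>'"
    and form_V: "bilinear_form_on s UNIV \<sigma>"
    and extends: "\<And>x y. x \<in> W \<Longrightarrow> y \<in> W \<Longrightarrow> \<sigma> x y = \<iota> (\<sigma>' x y)"
    and \<Gamma>_subspace: "module.subspace s \<Gamma>"
    and dim_\<Gamma>: "vector_space.dim s \<Gamma> = n - k"
    and \<Gamma>_W: "\<Gamma> \<inter> W = {0}"
    and quotient\<^sub>1: "quotient_projection s \<Gamma> s\<^sub>1 \<pi>\<^sub>1"
    and quotient\<^sub>2: "quotient_projection s (orth_compl \<sigma> \<Gamma>) s\<^sub>2 \<pi>\<^sub>2"

end

theory Submission
  imports Defs
begin

text \<open>
  Suppose an \<open>r\<close>-dimensional \<open>T\<close> violates the scattered property of \<open>U\<^sup>d\<close>.  Then \<open>r + 1\<close> vectors of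
  \<open>W\<close>, linearly independent over the large field, are projected into \<open>T\<close>, so some non-zero
  combination \<open>x\<close> of them lies in \<open>\<Gamma>\<^sup>\<perp>\<close>.  The hyperplane \<open>x\<^sup>\<perp>\<close> contains \<open>\<Gamma>\<close> and all vectors of \<open>W\<close>
  orthogonal to the \<open>r + 1\<close> given ones, so modulo \<open>\<Gamma>\<close> it is a hyperplane of weight at least
  \<open>n - r - 1\<close>, that is, of defect at least \<open>n - k - r\<close>.  For \<open>r < n - k - \<epsilon>\<close> this exceeds \<open>\<epsilon>\<close>, so the
  maximum defect of hyperplanes is the only larger value \<open>n - k\<close>, and some hyperplane has weight
  \<open>n - 1\<close>, contrary to hypothesis.
\<close>

section \<open>Linear algebra\<close>

lemma (in vector_space) finite_span:
  assumes "finite (UNIV :: 'a set)" "finite S"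
  shows "finite (span S)"
  using assms(2)
proof (induction S rule: finite_induct)
  case (insert a S)
  have "span (insert a S) \<subseteq> (\<Union>c. (\<lambda>x. c *s a + x) ` span S)"
  proof
    fix x assume "x \<in> span (insert a S)"
    then obtain c where "x - c *s a \<in> span S"
      by (auto simp: span_insert)
    then have "x \<in> (\<lambda>x. c *s a + x) ` span S"
      by (intro image_eqI[of _ _ "x - c *s a"]) auto
    then show "x \<in> (\<Union>c. (\<lambda>x. c *s a + x) ` span S)" by blast
  qed
  with insert assms(1) show ?case
    by (meson finite_UN_I finite_imageI finite_subset)
qed simp

text \<open>An infinite basis would have \<open>card\<close> 0, so a positive dimension forces a
  finite basis, and over a finite field its span is finite.\<close>

lemma (in vector_space) finite_UNIV_if_dim_pos:
  assumes "finite (UNIV :: 'a set)" "0 < dim UNIV"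
  shows "finite (UNIV :: 'b set)"
proof -
  obtain B where "UNIV \<subseteq> span B" "card B = dim UNIV"
    by (rule basis_exists[of UNIV])
  with assms finite_span[of B] show ?thesis
    by (metis card.infinite finite_subset less_numeral_extra(3))
qed

lemma (in vector_space) finite_dimensional_if_finite:
  assumes "finite (UNIV :: 'b set)"
  shows "finite_dimensional_vector_space scale (extend_basis {})"
  by unfold_locales
     (simp_all add: finite_subset[OF subset_UNIV assms] independent_extend_basis[OF independent_empty]
       span_extend_basis[OF independent_empty])

section \<open>Lifting independent sets, and rank-nullity\<close>

lemma (in vector_space_pair) exists_independent_lift:
  assumes lf: "Vector_Spaces.linear s1 s2 f" and "vs2.independent C" "C \<subseteq> f ` A"
  obtains S where "S \<subseteq> A" "f ` S = C" "inj_on f S" "vs1.independent S"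
proof -
  interpret lf: Vector_Spaces.linear s1 s2 f by fact
  obtain S where S: "S \<subseteq> A" "C = f ` S" "inj_on f S"
    using assms(3) by (auto simp: subset_image_inj)
  have "vs1.independent S"
  proof
    assume "vs1.dependent S"
    then obtain a where a: "a \<in> S" "a \<in> vs1.span (S - {a})"
      by (auto simp: vs1.dependent_def)
    then have "f a \<in> vs2.span (f ` (S - {a}))"
      using lf.span_image by blast
    moreover have "f ` (S - {a}) = f ` S - {f a}"
      using S(3) a(1) by (auto simp: inj_on_def)
    ultimately show False
      using assms(2) S(2) a(1) by (auto simp: vs2.dependent_def)
  qed
  with S show thesis by (intro that) auto
qed

text \<open>Rank-nullity on a subspace: extend a basis \<open>B\<close> of the kernel to a basis
  \<open>C\<close> of \<open>P\<close>; the added vectors \<open>D\<close> are mapped injectively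
  onto a spanning set of the image.\<close>

lemma (in finite_dimensional_vector_space_pair_1) dim_image_add_dim_kernel:
  assumes lf: "Vector_Spaces.linear s1 s2 f" and P: "vs1.subspace P"
  shows "vs1.dim P = vs2.dim (f ` P) + vs1.dim {x \<in> P. f x = 0}"
proof -
  interpret lf: Vector_Spaces.linear s1 s2 f by fact
  let ?K = "{x \<in> P. f x = 0}"
  obtain B where B: "B \<subseteq> ?K" "vs1.independent B" "?K \<subseteq> vs1.span B" "card B = vs1.dim ?K"
    by (rule vs1.basis_exists)
  obtain C where C: "B \<subseteq> C" "C \<subseteq> P" "vs1.independent C" "P \<subseteq> vs1.span C"
    using vs1.maximal_independent_subset_extend[of B P] B by blast
  define D where "D = C - B"
  have spanC: "vs1.span C = P"
    using C P by (simp add: vs1.span_subspace)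
  have fin: "finite C"
    using C(3) by (rule vs1.finiteI_independent)
  have D: "D \<subseteq> C" "vs1.independent D"
    using vs1.independent_mono[OF C(3)] by (auto simp: D_def)
  \<comment> \<open>A kernel vector in the span of \<open>D\<close> has its coordinates with respect
    to \<open>C\<close> supported both in \<open>D\<close> and in \<open>B\<close>, which are
    disjoint.\<close>
  have "x = 0" if x: "x \<in> vs1.span D" "f x = 0" for x
  proof -
    have xP: "x \<in> P"
      using x(1) D(1) spanC vs1.span_mono by blast
    with x(2) B(3) have xB: "x \<in> vs1.span B" by blast
    have "vs1.representation C x b = 0" for b
    proof (rule ccontr)
      assume ne: "vs1.representation C x b \<noteq> 0"
      have "vs1.representation C x = vs1.representation D x"
        "vs1.representation C x = vs1.representation B x"
        by (rule vs1.representation_extend[OF C(3) x(1) D(1)],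
            rule vs1.representation_extend[OF C(3) xB C(1)])
      with ne have "b \<in> D" "b \<in> B"
        using vs1.representation_ne_zero[of D x b] vs1.representation_ne_zero[of B x b] by simp_all
      then show False by (simp add: D_def)
    qed
    then show "x = 0"
      using vs1.sum_nonzero_representation_eq[OF C(3), of x] xP spanC by simp
  qed
  then have inj: "inj_on f (vs1.span D)"
    by (simp add: lf.inj_on_iff_eq_0)
  have "vs2.span (f ` C) = vs2.span (f ` D)"
  proof (rule vs2.span_eq[THEN iffD2], intro conjI)
    show "f ` C \<subseteq> vs2.span (f ` D)"
    proof
      fix y assume "y \<in> f ` C"
      then obtain c where c: "c \<in> C" "y = f c" by blast
      show "y \<in> vs2.span (f ` D)"
        using c B(1) by (cases "c \<in> B") (auto simp: D_def vs2.span_zero intro: vs2.span_base)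
    qed
    show "f ` D \<subseteq> vs2.span (f ` C)"
      using D(1) by (auto intro: vs2.span_base)
  qed
  then have "vs2.dim (f ` P) = vs2.dim (f ` D)"
    by (metis lf.span_image spanC vs2.dim_span)
  also have "\<dots> = card D"
    using dim_image_eq[OF lf inj] vs1.dim_eq_card_independent[OF D(2)] by simp
  finally show ?thesis
    using B(4) C fin card_mono[OF fin C(1)] vs1.dim_span_eq_card_independent[OF C(3)] spanC
    by (simp add: D_def card_Diff_subset finite_subset)
qed

section \<open>Linear functionals on a subspace and their kernels\<close>

text \<open>Linearity is demanded on \<open>Z\<close> only, because \<sigma>' is constrained only on
  \<open>W\<close>.\<close>

definition linear_functional_on ::
    "('f::field \<Rightarrow> 'v::ab_group_add \<Rightarrow> 'v) \<Rightarrow> 'v set \<Rightarrow> ('v \<Rightarrow> 'f) \<Rightarrow> bool" where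
  "linear_functional_on s Z f \<longleftrightarrow>
     (\<forall>x\<in>Z. \<forall>y\<in>Z. f (x + y) = f x + f y) \<and> (\<forall>c. \<forall>x\<in>Z. f (s c x) = c * f x)"

lemma linear_functional_on_subset:
  "linear_functional_on s Z f \<Longrightarrow> Z' \<subseteq> Z \<Longrightarrow> linear_functional_on s Z' f"
  by (auto simp: linear_functional_on_def subset_iff)

lemma (in vector_space) subspace_functional_kernel:
  assumes "subspace Z" "linear_functional_on scale Z f"
  shows "subspace {z \<in> Z. f z = 0}"
proof (rule subspaceI)
  have "f (0 *s 0) = 0 * f 0"
    using assms subspace_0 unfolding linear_functional_on_def by blast
  with assms show "0 \<in> {z \<in> Z. f z = 0}"
    by (simp add: subspace_0)
qed (use assms in \<open>auto simp: linear_functional_on_def subspace_add subspace_scale\<close>)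

lemma (in finite_dimensional_vector_space) dim_functional_kernel:
  assumes Z: "subspace Z" and f: "linear_functional_on scale Z f"
  shows "dim Z \<le> dim {z \<in> Z. f z = 0} + 1"
proof (cases "\<exists>z\<in>Z. f z \<noteq> 0")
  case True
  then obtain z where z: "z \<in> Z" "f z \<noteq> 0" by blast
  let ?N = "{z \<in> Z. f z = 0}"
  \<comment> \<open>Subtracting the right multiple of \<open>z\<close> moves any vector of
    \<open>Z\<close> into the kernel.\<close>
  have "Z \<subseteq> span (insert z ?N)"
  proof
    fix y assume y: "y \<in> Z"
    define c where "c = f y / f z"
    have "f (y + (- c) *s z) = f y + (- c) * f z"
      using f y z Z unfolding linear_functional_on_def by (metis subspace_scale)
    with z have "f (y - c *s z) = 0"
      by (simp add: c_def)
    moreover have "y - c *s z \<in> Z"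
      using Z y z by (simp add: subspace_diff subspace_scale)
    ultimately have "y - c *s z \<in> span ?N"
      by (simp add: span_base)
    then show "y \<in> span (insert z ?N)"
      by (auto simp: span_insert)
  qed
  then have "dim Z \<le> dim (insert z ?N)"
    by (rule dim_mono)
  then show ?thesis
    by (simp add: dim_insert split: if_splits)
next
  case False
  then have "{z \<in> Z. f z = 0} = Z" by auto
  then show ?thesis by simp
qed

text \<open>Each functional, restricted to the common kernel of the earlier ones, lowers the
  dimension by at most one.\<close>

lemma (in finite_dimensional_vector_space) dim_common_kernel:
  assumes Z: "subspace Z" and "finite S" and "\<And>a. a \<in> S \<Longrightarrow> linear_functional_on scale Z (f a)"
  shows "subspace {z \<in> Z. \<forall>a\<in>S. f a z = 0} \<and> dim Z \<le> dim {z \<in> Z. \<forall>a\<in>S. f a z = 0} + card S"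
  using assms(2,3)
proof (induction S rule: finite_induct)
  case (insert a S)
  let ?N = "{z \<in> Z. \<forall>a\<in>S. f a z = 0}"
  have N: "subspace ?N" "dim Z \<le> dim ?N + card S"
    using insert by auto
  have f: "linear_functional_on scale ?N (f a)"
    using linear_functional_on_subset[of scale Z "f a" ?N] insert.prems by auto
  have eq: "{z \<in> Z. \<forall>a\<in>insert a S. f a z = 0} = {z \<in> ?N. f a z = 0}" by auto
  show ?case
    unfolding eq
    using subspace_functional_kernel[OF N(1) f] dim_functional_kernel[OF N(1) f] N(2) insert.hyps
    by simp
qed (use Z in simp)

lemma bilinear_form_on_right:
  "bilinear_form_on s W \<beta> \<Longrightarrow> x \<in> W \<Longrightarrow> linear_functional_on s W (\<beta> x)"
  by (simp add: bilinear_form_on_def linear_functional_on_def)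

lemma bilinear_form_on_left:
  "bilinear_form_on s W \<beta> \<Longrightarrow> x \<in> W \<Longrightarrow> linear_functional_on s W (\<lambda>y. \<beta> y x)"
  by (simp add: bilinear_form_on_def linear_functional_on_def)

lemma (in vector_space) linear_functional_on_sum:
  assumes Z: "subspace Z" and f: "linear_functional_on scale Z f" and "finite B" "B \<subseteq> Z"
  shows "f (\<Sum>b\<in>B. c b *s b) = (\<Sum>b\<in>B. c b * f b)"
  using assms(3,4)
proof (induction B rule: finite_induct)
  case empty
  show ?case
    using subspace_0[OF subspace_functional_kernel[OF Z f]] by simp
next
  case (insert b B)
  have "c b *s b \<in> Z" "(\<Sum>b\<in>B. c b *s b) \<in> Z"
    using insert.prems Z by (auto intro!: subspace_sum subspace_scale)
  with insert f show ?case
    by (simp add: linear_functional_on_def)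
qed

section \<open>Restriction of scalars along a field embedding\<close>

lemma field_embedding_0: "field_embedding \<iota> \<Longrightarrow> \<iota> 0 = 0"
  unfolding field_embedding_def by (metis add_cancel_right_right)

lemma vector_space_restrict_scalars:
  assumes "field_embedding \<iota>" "vector_space s"
  shows "vector_space (restrict_scalars \<iota> s)"
proof -
  interpret vector_space s by fact
  show ?thesis
    using assms(1) unfolding restrict_scalars_def field_embedding_def
    by unfold_locales (simp_all add: algebra_simps)
qed

lemma linear_restrict_scalars:
  assumes "field_embedding \<iota>" "Vector_Spaces.linear s s' f"
  shows "Vector_Spaces.linear (restrict_scalars \<iota> s) (restrict_scalars \<iota> s') f"
  using assms(2) vector_space_restrict_scalars[OF assms(1), of s]
    vector_space_restrict_scalars[OF assms(1), of s']
  by (auto simp: Vector_Spaces.linear_iff restrict_scalars_def)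

lemma subspace_restrict_scalars:
  assumes "field_embedding \<iota>" "vector_space s" "module.subspace s T"
  shows "module.subspace (restrict_scalars \<iota> s) T"
proof -
  interpret vector_space s by fact
  interpret F: vector_space "restrict_scalars \<iota> s"
    by (rule vector_space_restrict_scalars) fact+
  show ?thesis
    using assms(3) unfolding F.subspace_def subspace_def by (simp add: restrict_scalars_def)
qed

text \<open>Over the small field the large one is a vector space in which \<open>{c}\<close> is
  independent, so \<open>c\<close> can be sent to 1. Scalars stand on the right to match the
  products in \<open>nondegenerate_V\<close>.\<close>

lemma field_embedding_exists_functional:
  fixes c :: "'k::field" and \<iota> :: "'f::field \<Rightarrow> 'k"
  assumes "field_embedding \<iota>" "c \<noteq> 0"
  obtains g where "\<And>x y. g (x + y) = g x + g y" "\<And>a x. g (x * \<iota> a) = g x * a" "g c = 1"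
proof -
  interpret K: vector_space "\<lambda>a x. \<iota> a * x"
    using assms(1) by unfold_locales (simp_all add: field_embedding_def algebra_simps)
  interpret F: vector_space "(*) :: 'f \<Rightarrow> 'f \<Rightarrow> 'f"
    by unfold_locales (simp_all add: algebra_simps)
  interpret vector_space_pair "\<lambda>a x. \<iota> a * x" "(*) :: 'f \<Rightarrow> 'f \<Rightarrow> 'f" ..
  obtain g where g: "Vector_Spaces.linear (\<lambda>a x. \<iota> a * x) (*) g" "g c = 1"
    using linear_independent_extend[of "{c}" "\<lambda>_. 1"] assms(2) by auto
  show thesis
    using g by (intro that[of g]) (auto simp: Vector_Spaces.linear_iff mult.commute)
qed

section \<open>The last two entries of a sorted list\<close>

text \<open>Whatever exceeds the penultimate entry must sit at the last index; this applies to both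
  \<open>x\<close> and the maximum.\<close>

lemma sorted_list_of_set_unique_above_penultimate:
  fixes M :: "'a::linorder set"
  assumes "finite M" "2 \<le> length (sorted_list_of_set M)"
    and "x \<in> M" "sorted_list_of_set M ! (length (sorted_list_of_set M) - 2) < x"
  shows "x = Max M"
proof -
  define L where "L = sorted_list_of_set M"
  have L: "set L = M" "sorted L" "2 \<le> length L" "L ! (length L - 2) < x"
    using assms by (simp_all add: L_def)
  have gt: "y = L ! (length L - 1)" if y: "y \<in> M" "L ! (length L - 2) < y" for y
  proof -
    obtain i where i: "i < length L" "L ! i = y"
      using y(1) L(1) by (auto simp: in_set_conv_nth)
    have "L ! i \<le> L ! (length L - 2)" if "i \<le> length L - 2"
      using that L(2,3) by (intro sorted_nth_mono) auto
    with i y(2) have "\<not> i \<le> length L - 2" by auto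
    with i have "i = length L - 1" by linarith
    with i show ?thesis by simp
  qed
  have "Max M \<in> M" "x \<le> Max M"
    using assms(1,3) by (auto intro: Max_in)
  with gt[of x] gt[of "Max M"] assms(3) L(4) show ?thesis by fastforce
qed

section \<open>The Delsarte dual\<close>

lemma image_mod_eq_image:
  assumes "Vector_Spaces.linear s s' p" "\<And>g. g \<in> G \<Longrightarrow> p g = 0" "0 \<in> G"
  shows "image_mod p W G = p ` W"
proof -
  interpret Vector_Spaces.linear s s' p by fact
  have "W \<subseteq> {w + g |w g. w \<in> W \<and> g \<in> G}"
    using assms(3) by (metis (mono_tags, lifting) add_0_right mem_Collect_eq subsetI)
  then show ?thesis
    using assms(2) by (auto simp: image_mod_def add)
qed

context delsarte_setting
begin

section \<open>The three spaces over both fields; the letter \<open>F\<close> marks the small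
  field\<close>

lemma linear_\<pi>\<^sub>1: "Vector_Spaces.linear s s\<^sub>1 \<pi>\<^sub>1" and surj_\<pi>\<^sub>1: "surj \<pi>\<^sub>1"
  and \<pi>\<^sub>1_eq_0_iff: "\<pi>\<^sub>1 v = 0 \<longleftrightarrow> v \<in> \<Gamma>"
  using quotient\<^sub>1 by (auto simp: quotient_projection_def)

lemma linear_\<pi>\<^sub>2: "Vector_Spaces.linear s s\<^sub>2 \<pi>\<^sub>2" and surj_\<pi>\<^sub>2: "surj \<pi>\<^sub>2"
  and \<pi>\<^sub>2_eq_0_iff: "\<pi>\<^sub>2 v = 0 \<longleftrightarrow> v \<in> orth_compl \<sigma> \<Gamma>"
  using quotient\<^sub>2 by (auto simp: quotient_projection_def)

lemma finite_V: "finite (UNIV :: 'v set)"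
  using dim_V k_less by (intro vector_space.finite_UNIV_if_dim_pos[OF vs]) auto

lemma finite_A: "finite (UNIV :: 'a set)"
  using finite_V surj_\<pi>\<^sub>1 by (metis finite_imageI)

lemma finite_B: "finite (UNIV :: 'b set)"
  using finite_V surj_\<pi>\<^sub>2 by (metis finite_imageI)

abbreviation "sF \<equiv> restrict_scalars \<iota> s"
abbreviation "sF\<^sub>1 \<equiv> restrict_scalars \<iota> s\<^sub>1"
abbreviation "sF\<^sub>2 \<equiv> restrict_scalars \<iota> s\<^sub>2"

lemma vs\<^sub>1: "vector_space s\<^sub>1" and vs\<^sub>2: "vector_space s\<^sub>2"
  using linear_\<pi>\<^sub>1 linear_\<pi>\<^sub>2 by (auto simp: Vector_Spaces.linear_iff)

lemmas vsF = vector_space_restrict_scalars[OF embedding vs]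
lemmas vsF\<^sub>1 = vector_space_restrict_scalars[OF embedding vs\<^sub>1]
lemmas vsF\<^sub>2 = vector_space_restrict_scalars[OF embedding vs\<^sub>2]

interpretation V: finite_dimensional_vector_space s "vector_space.extend_basis s {}"
  by (rule vector_space.finite_dimensional_if_finite[OF vs finite_V])
interpretation A: finite_dimensional_vector_space s\<^sub>1 "vector_space.extend_basis s\<^sub>1 {}"
  by (rule vector_space.finite_dimensional_if_finite[OF vs\<^sub>1 finite_A])
interpretation B: finite_dimensional_vector_space s\<^sub>2 "vector_space.extend_basis s\<^sub>2 {}"
  by (rule vector_space.finite_dimensional_if_finite[OF vs\<^sub>2 finite_B])
interpretation VF: finite_dimensional_vector_space sF "vector_space.extend_basis sF {}"
  by (rule vector_space.finite_dimensional_if_finite[OF vsF finite_V])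
interpretation AF: finite_dimensional_vector_space sF\<^sub>1 "vector_space.extend_basis sF\<^sub>1 {}"
  by (rule vector_space.finite_dimensional_if_finite[OF vsF\<^sub>1 finite_A])
interpretation BF: finite_dimensional_vector_space sF\<^sub>2 "vector_space.extend_basis sF\<^sub>2 {}"
  by (rule vector_space.finite_dimensional_if_finite[OF vsF\<^sub>2 finite_B])

interpretation VA: finite_dimensional_vector_space_pair_1 s "vector_space.extend_basis s {}" s\<^sub>1 ..
interpretation VB: finite_dimensional_vector_space_pair_1 s "vector_space.extend_basis s {}" s\<^sub>2 ..
interpretation VAF: finite_dimensional_vector_space_pair_1 sF "vector_space.extend_basis sF {}" sF\<^sub>1 ..
interpretation VBF: finite_dimensional_vector_space_pair_1 sF "vector_space.extend_basis sF {}" sF\<^sub>2 ..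

interpretation \<pi>\<^sub>1: Vector_Spaces.linear s s\<^sub>1 \<pi>\<^sub>1 by (rule linear_\<pi>\<^sub>1)
interpretation \<pi>\<^sub>2: Vector_Spaces.linear s s\<^sub>2 \<pi>\<^sub>2 by (rule linear_\<pi>\<^sub>2)

lemmas linear_\<pi>F\<^sub>1 = linear_restrict_scalars[OF embedding linear_\<pi>\<^sub>1]
lemmas linear_\<pi>F\<^sub>2 = linear_restrict_scalars[OF embedding linear_\<pi>\<^sub>2]

abbreviation "U \<equiv> image_mod \<pi>\<^sub>1 W \<Gamma>"
abbreviation "Ud \<equiv> image_mod \<pi>\<^sub>2 W (orth_compl \<sigma> \<Gamma>)"

lemma U_eq: "U = \<pi>\<^sub>1 ` W"
  by (rule image_mod_eq_image[OF linear_\<pi>\<^sub>1]) (simp_all flip: \<pi>\<^sub>1_eq_0_iff add: \<pi>\<^sub>1.zero)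

lemma Ud_eq: "Ud = \<pi>\<^sub>2 ` W"
  by (rule image_mod_eq_image[OF linear_\<pi>\<^sub>2]) (simp_all flip: \<pi>\<^sub>2_eq_0_iff add: \<pi>\<^sub>2.zero)

lemma subspace_Ud: "BF.subspace Ud"
  unfolding Ud_eq by (rule VBF.linear_subspace_image[OF linear_\<pi>F\<^sub>2 W_subspace])

section \<open>The position of \<open>W\<close> and non-degeneracy of \<sigma>\<close>

lemma inj_on_\<pi>\<^sub>1_W: "inj_on \<pi>\<^sub>1 W"
proof (rule inj_onI)
  fix x y assume xy: "x \<in> W" "y \<in> W" "\<pi>\<^sub>1 x = \<pi>\<^sub>1 y"
  then have "x - y \<in> \<Gamma> \<inter> W"
    using VF.subspace_diff[OF W_subspace] by (simp add: \<pi>\<^sub>1.diff flip: \<pi>\<^sub>1_eq_0_iff)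
  with \<Gamma>_W show "x = y" by simp
qed

lemma span_W_basis:
  assumes "W \<subseteq> VF.span C"
  shows "V.span C = UNIV"
proof -
  have "VF.subspace (V.span C)"
    by (rule subspace_restrict_scalars[OF embedding vs]) simp
  then have "VF.span C \<subseteq> V.span C"
    by (intro VF.span_minimal V.span_superset)
  with assms have "V.span W \<subseteq> V.span C"
    by (intro V.span_minimal) auto
  with span_W show ?thesis by auto
qed

text \<open>Extend \<open>S\<close> to a small-field basis of \<open>W\<close>. It has
  \<open>n\<close> elements and spans the \<open>n\<close>-dimensional space over the large field,
  so it is independent there too.\<close>

lemma independent_W:
  assumes "S \<subseteq> W" "VF.independent S"
  shows "V.independent S"
proof -
  obtain C where C: "S \<subseteq> C" "C \<subseteq> W" "VF.independent C" "W \<subseteq> VF.span C"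
    using VF.maximal_independent_subset_extend[OF assms] by blast
  have "card C = n"
    using VF.basis_card_eq_dim C dim_W by simp
  then have "V.independent C"
    using dim_V span_W_basis[OF C(4)] VF.finiteI_independent[OF C(3)]
    by (intro V.card_le_dim_spanning[of C UNIV]) auto
  then show ?thesis
    using C(1) by (rule V.independent_mono)
qed

text \<open>
  Applying \<open>'f\<close>-linear functionals of \<open>'k\<close> to the coordinates of \<open>x\<close> reduces this to the
  non-degeneracy of the form on \<open>W\<close>.
\<close>

lemma nondegenerate_V:
  assumes "\<And>w. w \<in> W \<Longrightarrow> \<sigma> x w = 0"
  shows "x = 0"
proof (rule ccontr)
  assume "x \<noteq> 0"
  obtain C where C: "C \<subseteq> W" "VF.independent C" "W \<subseteq> VF.span C"
    by (rule VF.basis_exists)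
  have fin: "finite C"
    using C(2) by (rule VF.finiteI_independent)
  have "x \<in> range (\<lambda>c. \<Sum>b\<in>C. s (c b) b)"
    unfolding V.span_finite[OF fin, symmetric] span_W_basis[OF C(3)] ..
  then obtain c where c: "x = (\<Sum>b\<in>C. s (c b) b)" by blast
  have "x = 0" if "\<forall>b\<in>C. c b = 0"
    using that by (simp add: c)
  with \<open>x \<noteq> 0\<close> obtain b where b: "b \<in> C" "c b \<noteq> 0" by blast
  obtain g where g: "\<And>x y. g (x + y) = g x + g y" "\<And>a x. g (x * \<iota> a) = g x * a" "g (c b) = 1"
    by (rule field_embedding_exists_functional[OF embedding b(2)]) blast
  have g0: "g 0 = 0"
    using g(1)[of 0 0] by (metis add_0_right add_left_cancel)
  have g_sum: "g (sum h C) = (\<Sum>b\<in>C. g (h b))" for h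
    using sum_comp_morphism[of g h C] g0 g(1) by (simp add: comp_def)
  \<comment> \<open>The vector \<open>y\<close> lies in \<open>W\<close> and pairs with each
    \<open>w\<close> in \<open>W\<close> to \<open>g\<close> of \<sigma>(\<open>x\<close>,
    \<open>w\<close>), which is \<open>g 0 = 0\<close>; its coordinate at \<open>b\<close> is
    1.\<close>
  define y where "y = (\<Sum>b\<in>C. sF (g (c b)) b)"
  have yW: "y \<in> W"
    unfolding y_def using C(1) by (intro VF.subspace_sum VF.subspace_scale W_subspace) auto
  have "\<sigma>' y w = 0" if w: "w \<in> W" for w
  proof -
    have "\<sigma>' y w = (\<Sum>b\<in>C. g (c b) * \<sigma>' b w)"
      unfolding y_def
      by (rule VF.linear_functional_on_sum[OF W_subspace bilinear_form_on_left[OF form_W w] fin C(1)])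
    also have "\<dots> = g (\<Sum>b\<in>C. c b * \<iota> (\<sigma>' b w))"
      by (simp add: g_sum g(2))
    also have "(\<Sum>b\<in>C. c b * \<iota> (\<sigma>' b w)) = (\<Sum>b\<in>C. c b * \<sigma> b w)"
      using C(1) w by (intro sum.cong) (auto simp: extends)
    also have "\<dots> = \<sigma> x w"
      unfolding c
      by (rule V.linear_functional_on_sum[OF V.subspace_UNIV bilinear_form_on_left[OF form_V] fin, symmetric])
        auto
    finally show ?thesis
      using assms[OF w] g0 by simp
  qed
  with yW nondegenerate_W have "y = 0"
    by (auto simp: nondegenerate_form_on_def)
  then have "g (c b) = 0"
    using VF.independentD[OF C(2) fin order_refl, of "\<lambda>b. g (c b)" b] b(1) by (simp add: y_def)
  with g(3) show False by simp
qed

section \<open>Dimensions and weights modulo \<Gamma>\<close>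

lemma dim_eq_dim_image_\<pi>\<^sub>1:
  assumes "V.subspace P" "\<Gamma> \<subseteq> P"
  shows "V.dim P = A.dim (\<pi>\<^sub>1 ` P) + (n - k)"
proof -
  have "{v \<in> P. \<pi>\<^sub>1 v = 0} = \<Gamma>"
    using assms(2) by (auto simp: \<pi>\<^sub>1_eq_0_iff)
  then show ?thesis
    using VA.dim_image_add_dim_kernel[OF linear_\<pi>\<^sub>1 assms(1)] dim_\<Gamma> by simp
qed

lemma dim_A: "A.dim UNIV = k"
  using dim_eq_dim_image_\<pi>\<^sub>1[of UNIV] dim_V surj_\<pi>\<^sub>1 k_less by simp

lemma weight_UNIV: "weight \<iota> s\<^sub>1 U UNIV = n"
proof -
  have "inj_on \<pi>\<^sub>1 (VF.span W)"
    unfolding VF.span_eq_iff[THEN iffD2, OF W_subspace] by (rule inj_on_\<pi>\<^sub>1_W)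
  then have "AF.dim (\<pi>\<^sub>1 ` W) = VF.dim W"
    by (rule VAF.dim_image_eq[OF linear_\<pi>F\<^sub>1])
  then show ?thesis
    by (simp add: weight_def U_eq dim_W)
qed

text \<open>A small-field basis of \<open>U \<inter> T\<close> lifts to vectors of \<open>W\<close>
  in the preimage of \<open>T\<close>. By \<open>independent_W\<close> they are independent over the
  large field, so the dimension of the preimage bounds their number. Hence no defect exceeds
  \<open>n - k\<close>.\<close>

lemma weight_le:
  assumes T: "A.subspace T"
  shows "weight \<iota> s\<^sub>1 U T \<le> A.dim T + (n - k)"
proof -
  obtain C where C: "C \<subseteq> U \<inter> T" "AF.independent C" "card C = AF.dim (U \<inter> T)"
    by (rule AF.basis_exists)
  have "C \<subseteq> \<pi>\<^sub>1 ` W"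
    using C(1) by (auto simp: U_eq)
  then obtain S where S: "S \<subseteq> W" "\<pi>\<^sub>1 ` S = C" "inj_on \<pi>\<^sub>1 S" "VF.independent S"
    by (rule VAF.exists_independent_lift[OF linear_\<pi>F\<^sub>1 C(2)])
  let ?P = "\<pi>\<^sub>1 -` T"
  have P: "V.subspace ?P" "\<Gamma> \<subseteq> ?P" "\<pi>\<^sub>1 ` ?P = T"
    using VA.linear_subspace_vimage[OF linear_\<pi>\<^sub>1 T] A.subspace_0[OF T] \<pi>\<^sub>1_eq_0_iff surj_\<pi>\<^sub>1
    by (auto simp: surj_image_vimage_eq)
  have "card S \<le> V.dim ?P"
    using C(1) S by (intro V.independent_card_le_dim independent_W) auto
  moreover have "card S = weight \<iota> s\<^sub>1 U T"
    using card_image[OF S(3)] S(2) C(3) by (simp add: weight_def)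
  ultimately show ?thesis
    using dim_eq_dim_image_\<pi>\<^sub>1[OF P(1,2)] P(3) by simp
qed

section \<open>Heavy hyperplanes from a failure of scatteredness\<close>

text \<open>The witness is the image of the hyperplane orthogonal to \<open>x\<close>: it inherits
  every vector of \<open>W\<close> orthogonal to all of \<open>S\<close>, and those orthogonality
  conditions cost at most \<open>card S\<close> dimensions.\<close>

lemma exists_heavy_hyperplane:
  assumes S: "S \<subseteq> W" and x: "x \<in> V.span S" "x \<noteq> 0" "\<pi>\<^sub>2 x = 0"
  obtains H where "A.subspace H" "A.dim H = k - 1" "n \<le> weight \<iota> s\<^sub>1 U H + card S"
proof -
  \<comment> \<open>With \<open>x\<close> in the first argument, as in \<open>orth_compl\<close>,
    the condition \<open>\<pi>\<^sub>2 x = 0\<close> says exactly that \<Gamma> lies in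
    \<open>P\<close>.\<close>
  define P where "P = {v \<in> UNIV. \<sigma> x v = 0}"
  note form_x = bilinear_form_on_right[OF form_V UNIV_I[of x]]
  have P: "V.subspace P"
    unfolding P_def by (rule V.subspace_functional_kernel[OF V.subspace_UNIV form_x])
  have \<Gamma>_P: "\<Gamma> \<subseteq> P"
    using x(3) by (auto simp: P_def \<pi>\<^sub>2_eq_0_iff orth_compl_def)
  have "P \<noteq> UNIV"
    using nondegenerate_V x(2) by (auto simp: P_def)
  then have "V.dim P < n"
    using V.dim_psubset[of P UNIV] V.span_eq_iff[THEN iffD2, OF P] dim_V
    by (simp only: V.span_UNIV psubset_eq subset_UNIV) simp
  moreover have "n \<le> V.dim P + 1"
    using V.dim_functional_kernel[OF V.subspace_UNIV form_x] dim_V by (simp add: P_def)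
  ultimately have dim_P: "V.dim P = n - 1" by linarith
  define Z where "Z = {w \<in> W. \<forall>a\<in>S. \<sigma>' a w = 0}"
  have finS: "finite S"
    using finite_V by (rule finite_subset[OF subset_UNIV])
  have Z: "VF.subspace Z" "n \<le> VF.dim Z + card S"
    using VF.dim_common_kernel[OF W_subspace finS, of \<sigma>'] S dim_W bilinear_form_on_right[OF form_W]
    by (auto simp: Z_def)
  have ZP: "Z \<subseteq> W \<inter> P"
  proof
    fix w assume w: "w \<in> Z"
    \<comment> \<open>For fixed \<open>w\<close> the vectors left-orthogonal to \<open>w\<close>
      form a subspace over the large field, so orthogonality passes from \<open>S\<close> to the
      combination \<open>x\<close>.\<close>
    have "V.span S \<subseteq> {y \<in> UNIV. \<sigma> y w = 0}"
    proof (rule V.span_minimal)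
      show "S \<subseteq> {y \<in> UNIV. \<sigma> y w = 0}"
        using w S field_embedding_0[OF embedding] by (auto simp: Z_def extends subset_iff)
    qed (intro V.subspace_functional_kernel V.subspace_UNIV bilinear_form_on_left[OF form_V] UNIV_I)
    with x(1) w show "w \<in> W \<inter> P"
      by (auto simp: Z_def P_def)
  qed
  \<comment> \<open>No dimension of \<open>Z\<close> is lost modulo \<Gamma>, since the projection
    is injective on \<open>W\<close>.\<close>
  have "VF.dim Z = AF.dim (\<pi>\<^sub>1 ` Z)"
    using VF.span_eq_iff[THEN iffD2, OF Z(1)] ZP inj_on_subset[OF inj_on_\<pi>\<^sub>1_W, of Z]
    by (intro VAF.dim_image_eq[OF linear_\<pi>F\<^sub>1, symmetric]) (simp only: le_inf_iff)
  also have "\<dots> \<le> weight \<iota> s\<^sub>1 U (\<pi>\<^sub>1 ` P)"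
    unfolding weight_def U_eq using ZP by (intro AF.dim_subset) auto
  finally show thesis
    using Z(2) dim_P dim_eq_dim_image_\<pi>\<^sub>1[OF P \<Gamma>_P] k_less k_pos
    by (intro that[of "\<pi>\<^sub>1 ` P"] VA.linear_subspace_image[OF linear_\<pi>\<^sub>1 P]) auto
qed

text \<open>The lift \<open>S\<close> of \<open>r + 1\<close> independent vectors of
  \<open>Ud \<inter> T\<close> stays independent over the large field, while its image lies in the
  \<open>r\<close>-dimensional \<open>T\<close>; the resulting kernel vector feeds
  \<open>exists_heavy_hyperplane\<close>.\<close>

lemma exists_heavy_hyperplane_if_dual_not_scattered:
  assumes "\<not> h_scattered \<iota> s\<^sub>2 r Ud"
  obtains H where "A.subspace H" "A.dim H = k - 1" "n \<le> weight \<iota> s\<^sub>1 U H + r + 1"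
proof -
  obtain T where T: "B.subspace T" "B.dim T = r" "r < BF.dim (Ud \<inter> T)"
    using assms subspace_Ud by (auto simp: h_scattered_def not_le)
  obtain C' where C': "C' \<subseteq> Ud \<inter> T" "BF.independent C'" "card C' = BF.dim (Ud \<inter> T)"
    by (rule BF.basis_exists)
  \<comment> \<open>One vector more than the dimension of \<open>T\<close> suffices; taking no more
    keeps the loss of weight at \<open>r + 1\<close>.\<close>
  obtain C where C: "C \<subseteq> C'" "card C = r + 1"
    using T(3) C'(3) obtain_subset_with_card_n[of "r + 1" C'] by auto
  have indep_C: "BF.independent C"
    using C'(2) C(1) by (rule BF.independent_mono)
  have "C \<subseteq> \<pi>\<^sub>2 ` W"
    using C(1) C'(1) by (auto simp: Ud_eq)
  then obtain S where S: "S \<subseteq> W" "\<pi>\<^sub>2 ` S = C" "inj_on \<pi>\<^sub>2 S" "VF.independent S"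
    by (rule VBF.exists_independent_lift[OF linear_\<pi>F\<^sub>2 indep_C])
  have card_S: "card S = r + 1"
    using C(2) S(2,3) card_image by fastforce
  have "\<not> inj_on \<pi>\<^sub>2 (V.span S)"
  proof
    assume "inj_on \<pi>\<^sub>2 (V.span S)"
    then have "B.dim C = V.dim S"
      using VB.dim_image_eq[OF linear_\<pi>\<^sub>2] S(2) by blast
    also have "\<dots> = r + 1"
      using V.dim_eq_card_independent independent_W[OF S(1,4)] card_S by simp
    finally show False
      using B.dim_subset[of C T] C(1) C'(1) T(2) by auto
  qed
  then obtain x where "x \<in> V.span S" "x \<noteq> 0" "\<pi>\<^sub>2 x = 0"
    by (auto simp: \<pi>\<^sub>2.inj_on_iff_eq_0)
  from exists_heavy_hyperplane[OF S(1) this] that show thesis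
    by (metis card_S add.assoc)
qed

section \<open>Maximum defects\<close>

lemma finite_defects: "finite {defect \<iota> s\<^sub>1 U T | T. A.subspace T \<and> A.dim T = r}"
proof -
  have "finite (UNIV :: 'a set set)"
    using finite_A by (simp add: Finite_Set.finite_set)
  then show ?thesis
    by (intro finite_image_set) (rule finite_subset[OF subset_UNIV])
qed

lemma defect_le_max_defect:
  assumes "A.subspace T"
  shows "defect \<iota> s\<^sub>1 U T \<le> max_defect \<iota> s\<^sub>1 U (A.dim T)"
  unfolding max_defect_def using assms finite_defects by (intro Max_ge) auto

text \<open>For \<open>r \<le> k\<close> subspaces of dimension \<open>r\<close> exist, so
  \<open>Max\<close> ranges over a non-empty finite set and is one of its members.\<close>

lemma max_defect_attained:
  assumes "r \<le> k"
  obtains T where "A.subspace T" "A.dim T = r" "max_defect \<iota> s\<^sub>1 U r = defect \<iota> s\<^sub>1 U T"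
proof -
  obtain T where "A.subspace T" "A.dim T = r"
    using A.choose_subspace_of_subspace[of r UNIV] assms dim_A by auto
  then have "{defect \<iota> s\<^sub>1 U T | T. A.subspace T \<and> A.dim T = r} \<noteq> {}" by blast
  from Max_in[OF finite_defects this] that show thesis
    unfolding max_defect_def by blast
qed

lemma max_defect_le:
  assumes "r \<le> k"
  shows "max_defect \<iota> s\<^sub>1 U r \<le> int n - int k"
proof -
  obtain T where "A.subspace T" "max_defect \<iota> s\<^sub>1 U r = defect \<iota> s\<^sub>1 U T"
    by (rule max_defect_attained[OF assms])
  with weight_le[of T] k_less show ?thesis
    by (simp add: defect_def)
qed

lemma max_defect_k: "max_defect \<iota> s\<^sub>1 U k = int n - int k"
  using defect_le_max_defect[OF A.subspace_UNIV] max_defect_le[of k]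
  unfolding defect_def weight_UNIV dim_A by simp

section \<open>Scatteredness of the dual\<close>

text \<open>Leaving \<open>r\<close> free covers both claims of the theorem. A failure would make
  the maximum defect of hyperplanes exceed \<epsilon>, hence equal \<open>n - k\<close>, and a
  hyperplane attaining it would have weight \<open>n - 1\<close>.\<close>

lemma h_scattered_dual:
  assumes hyperplanes: "\<And>H. A.subspace H \<Longrightarrow> A.dim H = k - 1 \<Longrightarrow> weight \<iota> s\<^sub>1 U H < n - 1"
    and count: "2 \<le> defect_count \<iota> s\<^sub>1 U"
    and \<epsilon>: "\<epsilon> = max_defect \<iota> s\<^sub>1 U (defect_position \<iota> s\<^sub>1 U (defect_count \<iota> s\<^sub>1 U - 1))"
  shows "\<epsilon> < int n - int k" and "int r < int n - int k - \<epsilon> \<Longrightarrow> h_scattered \<iota> s\<^sub>2 r Ud"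
proof -
  define M where
    "M = {max_defect \<iota> s\<^sub>1 U r | r. r \<le> A.dim UNIV \<and> 0 < max_defect \<iota> s\<^sub>1 U r}"
  have finM: "finite M"
    unfolding M_def by (rule finite_subset[of _ "max_defect \<iota> s\<^sub>1 U ` {..k}"]) (auto simp: dim_A simp del: A.dim_UNIV)
  let ?L = "sorted_list_of_set M"
  have L: "defect_values \<iota> s\<^sub>1 U = ?L" "defect_count \<iota> s\<^sub>1 U = length ?L"
    by (simp_all add: defect_values_def defect_count_def M_def)
  have len: "2 \<le> length ?L"
    using count L by simp
  have mem: "?L ! i \<in> M" if "i < length ?L" for i
    using that finM by (metis nth_mem set_sorted_list_of_set)
  have "?L ! (length ?L - 2) \<in> M"
    using len by (intro mem) linarith
  then obtain r' where "r' \<le> A.dim UNIV \<and> max_defect \<iota> s\<^sub>1 U r' = ?L ! (length ?L - 2)"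
    by (auto simp: M_def)
  \<comment> \<open>Term \<open>s - 1\<close> of the sequence has list index \<open>s - 2\<close>;
    the value at the least position is that entry, whichever position it is.\<close>
  from LeastI[of "\<lambda>r. r \<le> A.dim UNIV \<and> max_defect \<iota> s\<^sub>1 U r = ?L ! (length ?L - 2)", OF this]
  have \<epsilon>_eq: "\<epsilon> = ?L ! (length ?L - 2)"
    using \<epsilon> by (simp add: defect_position_def L numeral_2_eq_2)
  have M_le: "x \<le> int n - int k" if "x \<in> M" for x
    using that max_defect_le dim_A by (auto simp: M_def)
  have above: "x = Max M" if "x \<in> M" "\<epsilon> < x" for x
    using sorted_list_of_set_unique_above_penultimate[OF finM len] that \<epsilon>_eq by simp
  have "?L ! (length ?L - 2) < ?L ! (length ?L - 1)"
    using len by (intro sorted_wrt_nth_less[OF strict_sorted_list_of_set]) auto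
  moreover have "?L ! (length ?L - 1) \<le> int n - int k"
    using len by (intro M_le mem) linarith
  ultimately show lt: "\<epsilon> < int n - int k"
    using \<epsilon>_eq by linarith
  \<comment> \<open>This value is attained by the whole space, at \<open>r = k\<close>.\<close>
  have "int n - int k \<in> M"
    using k_less dim_A max_defect_k by (force simp: M_def)
  with lt above have Max_M: "Max M = int n - int k" by metis
  have \<epsilon>_pos: "0 < \<epsilon>"
    using \<open>?L ! (length ?L - 2) \<in> M\<close> \<epsilon>_eq by (auto simp: M_def)
  show "h_scattered \<iota> s\<^sub>2 r Ud" if r: "int r < int n - int k - \<epsilon>"
  proof (rule ccontr)
    assume "\<not> h_scattered \<iota> s\<^sub>2 r Ud"
    then obtain H where H: "A.subspace H" "A.dim H = k - 1" "n \<le> weight \<iota> s\<^sub>1 U H + r + 1"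
      by (rule exists_heavy_hyperplane_if_dual_not_scattered)
    \<comment> \<open>The defect is at least
      \<open>(n - r - 1) - (k - 1) = n - k - r\<close>.\<close>
    have "\<epsilon> < defect \<iota> s\<^sub>1 U H"
      using H r k_pos by (simp add: defect_def)
    also have "\<dots> \<le> max_defect \<iota> s\<^sub>1 U (k - 1)"
      using defect_le_max_defect[OF H(1)] H(2) by simp
    finally have gt: "\<epsilon> < max_defect \<iota> s\<^sub>1 U (k - 1)" .
    \<comment> \<open>Only positive values belong to \<open>M\<close>; positivity comes from that of
      \<epsilon>.\<close>
    have "max_defect \<iota> s\<^sub>1 U (k - 1) \<in> M"
      unfolding M_def dim_A using gt \<epsilon>_pos by (intro CollectI exI[of _ "k - 1"]) auto
    with gt above Max_M have "max_defect \<iota> s\<^sub>1 U (k - 1) = int n - int k" by metis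
    \<comment> \<open>A maximising \<open>T\<close>, possibly different from \<open>H\<close>, has
      weight \<open>(n - k) + (k - 1) = n - 1\<close>.\<close>
    moreover obtain T where "A.subspace T" "A.dim T = k - 1"
      "max_defect \<iota> s\<^sub>1 U (k - 1) = defect \<iota> s\<^sub>1 U T"
      by (rule max_defect_attained[of "k - 1"]) auto
    ultimately show False
      using hyperplanes[of T] k_pos k_less by (simp add: defect_def)
  qed
qed

end

theorem theorem1p30:
  fixes q m n k h :: nat
    and \<iota> :: "'f::{field,finite} \<Rightarrow> 'k::{field,finite}"
    and s :: "'k \<Rightarrow> 'v::ab_group_add \<Rightarrow> 'v"
    and W \<Gamma> :: "'v set"
    and \<sigma>' :: "'v \<Rightarrow> 'v \<Rightarrow> 'f"
    and \<sigma> :: "'v \<Rightarrow> 'v \<Rightarrow> 'k"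
    and s\<^sub>1 :: "'k \<Rightarrow> 'a::ab_group_add \<Rightarrow> 'a"
    and \<pi>\<^sub>1 :: "'v \<Rightarrow> 'a"
    and s\<^sub>2 :: "'k \<Rightarrow> 'b::ab_group_add \<Rightarrow> 'b"
    and \<pi>\<^sub>2 :: "'v \<Rightarrow> 'b"
    and U :: "'a set"
    and Ud :: "'b set"
    and \<epsilon> :: int
  assumes setting: "delsarte_setting q m n k \<iota> s W \<sigma>' \<sigma> \<Gamma> s\<^sub>1 \<pi>\<^sub>1 s\<^sub>2 \<pi>\<^sub>2"
    and U: "U = image_mod \<pi>\<^sub>1 W \<Gamma>"
    and Ud: "Ud = image_mod \<pi>\<^sub>2 W (orth_compl \<sigma> \<Gamma>)"
    and hyperplanes: "\<And>H. module.subspace s\<^sub>1 H \<Longrightarrow> vector_space.dim s\<^sub>1 H = k - 1 \<Longrightarrow>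
                          weight \<iota> s\<^sub>1 U H < n - 1"
    and h_pos: "0 < h"
    and scattered_U: "h_scattered \<iota> s\<^sub>1 h U"
    and count: "2 \<le> defect_count \<iota> s\<^sub>1 U"
    and \<epsilon>: "\<epsilon> = max_defect \<iota> s\<^sub>1 U (defect_position \<iota> s\<^sub>1 U (defect_count \<iota> s\<^sub>1 U - 1))"
  shows "h_scattered \<iota> s\<^sub>2 (nat (int n - int k - \<epsilon> - 1)) Ud
         \<and> (\<epsilon> < int n - int k - 1 \<longrightarrow> scattered \<iota> s\<^sub>2 Ud)"
proof -
  interpret delsarte_setting q m n k \<iota> s W \<sigma>' \<sigma> \<Gamma> s\<^sub>1 \<pi>\<^sub>1 s\<^sub>2 \<pi>\<^sub>2
    by (rule setting)
  note dual = h_scattered_dual[OF hyperplanes[unfolded U] count[unfolded U] \<epsilon>[unfolded U], folded Ud]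
  \<comment> \<open>The bound \<open>\<epsilon> < n - k\<close> makes the argument of
    \<open>nat\<close> non-negative, so the conversion is exact; \<open>r = 1\<close> gives the
    scattered case.\<close>
  show ?thesis
    using dual(1) dual(2)[of "nat (int n - int k - \<epsilon> - 1)"] dual(2)[of 1] by auto
qed

end
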